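(* Let $G$ be a 2-connected graph, $G'$ a graph, and $f$ a circuit injection from $G$ onto $G'$. Let $v$ be a vertex of $G'$ and $S=S(v)$ its star. Let $G-f^{-1}(S)$ denote the subgraph of $G$ with the same vertex set as $G$ and with edge set consisting of the edges of $G$ not in $f^{-1}(S)$. Then $G-f^{-1}(S)$ has exactly two connected components $G_1$ and $G_2$ (so $G=G_1\cup G_2\cup f^{-1}(S)$), and each edge of $f^{-1}(S)$ has one end vertex in $G_1$ and the other in $G_2$.
   Context: Graphs are undirected, finite or infinite, without loops or multiple edges; a circuit is a (finite) cycle, regarded as its set of edges. For a vertex $v$, the star subgraph $S(v)$ is the set of all edges incident to $v$. A circuit injection from $G$ onto $G'$ is a one-to-one map $f$ from the edge set of $G$ onto the edge set of $G'$ such that $f(C)$ is a circuit of $G'$ whenever $C$ is a circuit of $G$; "onto $G'$" includes the requirement that $G'$ has no isolated vertices. *)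

theory Defs
  imports Main
begin

record 'v ugraph =
  verts :: "'v set"
  edges :: "'v set set"

definition simple_graph :: "'v ugraph \<Rightarrow> bool" where
  "simple_graph G \<longleftrightarrow> (\<forall>e\<in>edges G. e \<subseteq> verts G \<and> card e = 2)"

definition subgraph :: "'v ugraph \<Rightarrow> 'v ugraph \<Rightarrow> bool" where
  "subgraph H G \<longleftrightarrow> simple_graph H \<and> verts H \<subseteq> verts G \<and> edges H \<subseteq> edges G"

definition graph_union :: "'v ugraph \<Rightarrow> 'v ugraph \<Rightarrow> 'v ugraph" where
  "graph_union G H = \<lparr>verts = verts G \<union> verts H, edges = edges G \<union> edges H\<rparr>"

definition add_edges :: "'v ugraph \<Rightarrow> 'v set set \<Rightarrow> 'v ugraph" where
  "add_edges G F = G\<lparr>edges := edges G \<union> F\<rparr>"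

definition delete_edges :: "'v ugraph \<Rightarrow> 'v set set \<Rightarrow> 'v ugraph" where
  "delete_edges G F = G\<lparr>edges := edges G - F\<rparr>"

definition delete_verts :: "'v ugraph \<Rightarrow> 'v set \<Rightarrow> 'v ugraph" where
  "delete_verts G X = \<lparr>verts = verts G - X, edges = {e \<in> edges G. e \<inter> X = {}}\<rparr>"

definition adjacent :: "'v ugraph \<Rightarrow> 'v \<Rightarrow> 'v \<Rightarrow> bool" where
  "adjacent G u v \<longleftrightarrow> {u, v} \<in> edges G"

definition connected_graph :: "'v ugraph \<Rightarrow> bool" where
  "connected_graph G \<longleftrightarrow>
     verts G \<noteq> {} \<and> (\<forall>u\<in>verts G. \<forall>v\<in>verts G. (adjacent G)\<^sup>*\<^sup>* u v)"

text \<open>The usual convention that a \<open>k\<close>-connected graph has more than \<open>k\<close> vertices is adopted;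
  infinite graphs satisfy this requirement for every \<open>k\<close>.\<close>

definition k_connected :: "nat \<Rightarrow> 'v ugraph \<Rightarrow> bool" where
  "k_connected k G \<longleftrightarrow>
     (finite (verts G) \<longrightarrow> k < card (verts G)) \<and>
     (\<forall>X \<subseteq> verts G. finite X \<and> card X < k \<longrightarrow> connected_graph (delete_verts G X))"

definition components :: "'v ugraph \<Rightarrow> 'v ugraph set" where
  "components G =
     {H. subgraph H G \<and> connected_graph H \<and>
         (\<forall>K. subgraph K G \<and> connected_graph K \<and> subgraph H K \<longrightarrow> K = H)}"

text \<open>A circuit is the edge set of a cycle whose distinct vertices are listed in cyclic order.\<close>

definition circuit :: "'v ugraph \<Rightarrow> 'v set set \<Rightarrow> bool" where
  "circuit G C \<longleftrightarrow>
     (\<exists>vs. 3 \<le> length vs \<and> distinct vs \<and> C \<subseteq> edges G \<and>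
        C = {{vs ! i, vs ! (Suc i mod length vs)} | i. i < length vs})"

definition star :: "'v ugraph \<Rightarrow> 'v \<Rightarrow> 'v set set" where
  "star G v = {e \<in> edges G. v \<in> e}"

text \<open>The last conjunct says that \<open>G'\<close> has no isolated vertices. It is part of the notion, as a map
  on edges alone cannot account for isolated vertices.\<close>

definition circuit_injection ::
  "'v ugraph \<Rightarrow> 'w ugraph \<Rightarrow> ('v set \<Rightarrow> 'w set) \<Rightarrow> bool" where
  "circuit_injection G G' f \<longleftrightarrow>
     bij_betw f (edges G) (edges G') \<and>
     (\<forall>C. circuit G C \<longrightarrow> circuit G' (f ` C)) \<and>
     (\<forall>v\<in>verts G'. star G' v \<noteq> {})"

definition edge_preimage :: "'v ugraph \<Rightarrow> ('v set \<Rightarrow> 'w set) \<Rightarrow> 'w set set \<Rightarrow> 'v set set" where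
  "edge_preimage G f S = {e \<in> edges G. f e \<in> S}"

end

theory Submission
  imports Defs
begin

text \<open>
  Every circuit of \<open>G'\<close> meets the star of \<open>v\<close> in no edge or in exactly two edges, so every circuit
  of \<open>G\<close> meets \<open>T = f\<^sup>-\<^sup>1(S)\<close> in no edge or in exactly two. Hence the ends of an edge of \<open>T\<close> lie
  in different components of \<open>G - T\<close>: a path of \<open>G - T\<close> between them would close up to a circuit
  with a single edge in \<open>T\<close>. Since \<open>G\<close> is 2-connected, two edges \<open>h\<close>, \<open>e\<close> of \<open>T\<close> lie on a common
  circuit, and removing \<open>h\<close> and \<open>e\<close> from it leaves two (possibly trivial) paths of \<open>G - T\<close> that
  join the ends of \<open>h\<close> to the ends of \<open>e\<close>. So all edges of \<open>T\<close> join the same two components, and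
  as \<open>G\<close> is connected there are no others.
\<close>

section \<open>Paths\<close>

text \<open>A path is its vertex list, with distinctness stated separately so that lists can be cut
  and spliced. A one-vertex list is the trivial path and has no edges.\<close>

fun path_edges :: "'v list \<Rightarrow> 'v set set" where
  "path_edges (x # y # xs) = insert {x, y} (path_edges (y # xs))"
| "path_edges _ = {}"

lemma path_edges_append:
  "path_edges (xs @ y # ys) = path_edges (xs @ [y]) \<union> path_edges (y # ys)"
  by (induction xs rule: path_edges.induct) auto

lemma path_edges_rev: "path_edges (rev xs) = path_edges xs"
proof (induction xs rule: path_edges.induct)
  case (1 x y xs)
  have "path_edges (rev (x # y # xs)) = path_edges (rev xs @ y # [x])"
    by simp
  also have "\<dots> = path_edges (rev (y # xs)) \<union> {{y, x}}"
    by (subst path_edges_append) simp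
  finally show ?case
    using 1 by (auto simp: insert_commute)
qed auto

text \<open>Links the recursive form to the indexed form used by \<open>circuit\<close>.\<close>

lemma path_edges_conv_nth:
  "path_edges xs = {{xs ! i, xs ! Suc i} | i. Suc i < length xs}"
proof (induction xs rule: path_edges.induct)
  case (1 x y xs)
  have "{{(x # y # xs) ! i, (x # y # xs) ! Suc i} | i. Suc i < length (x # y # xs)} =
    insert {x, y} {{(y # xs) ! i, (y # xs) ! Suc i} | i. Suc i < length (y # xs)}"
    (is "?A = insert _ ?B")
  proof (intro equalityI subsetI)
    fix e assume "e \<in> ?A"
    then obtain i where i: "e = {(x # y # xs) ! i, (x # y # xs) ! Suc i}"
      "Suc i < length (x # y # xs)" by blast
    then show "e \<in> insert {x, y} ?B"
      by (cases i) auto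
  next
    fix e assume "e \<in> insert {x, y} ?B"
    then consider "e = {x, y}"
      | i where "e = {(y # xs) ! i, (y # xs) ! Suc i}" "Suc i < length (y # xs)" by blast
    then show "e \<in> ?A"
    proof cases
      case 1
      then show ?thesis by (intro CollectI exI[of _ 0]) auto
    next
      case (2 i)
      then show ?thesis by (intro CollectI exI[of _ "Suc i"]) auto
    qed
  qed
  then show ?case using 1 by simp
qed auto

lemma path_edges_split:
  assumes "e \<in> path_edges p"
  shows "\<exists>p1 u w p2. p = p1 @ u # w # p2 \<and> e = {u, w}"
  using assms
proof (induction p rule: path_edges.induct)
  case (1 x y xs)
  then show ?case
    by (metis append_Cons append_Nil insert_iff path_edges.simps(1))
qed auto

lemma Union_path_edges: "2 \<le> length p \<Longrightarrow> \<Union> (path_edges p) = set p"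
proof (induction p rule: path_edges.induct)
  case (1 x y xs)
  then show ?case by (cases xs) auto
qed auto

lemma Union_path_edges_subset: "\<Union> (path_edges p) \<subseteq> set p"
  by (induction p rule: path_edges.induct) auto

lemma reachable_imp_path:
  assumes "(adjacent G)\<^sup>*\<^sup>* x y"
  obtains p where "distinct p" "p \<noteq> []" "hd p = x" "last p = y" "path_edges p \<subseteq> edges G"
proof -
  have "\<exists>p. distinct p \<and> p \<noteq> [] \<and> hd p = x \<and> last p = y \<and> path_edges p \<subseteq> edges G"
    using assms
  proof (induction rule: converse_rtranclp_induct)
    case base
    show ?case by (intro exI[of _ "[y]"]) auto
  next
    case (step x z)
    then obtain p where p: "distinct p" "p \<noteq> []" "hd p = z" "last p = y" "path_edges p \<subseteq> edges G"
      by blast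
    show ?case
    proof (cases "x \<in> set p")
      case True
      \<comment> \<open>The path already visits \<open>x\<close>; taking only its part from
        \<open>x\<close> on keeps the list distinct.\<close>
      then obtain p1 p2 where "p = p1 @ x # p2" by (meson split_list)
      with p path_edges_append[of p1 x p2] show ?thesis
        by (intro exI[of _ "x # p2"]) auto
    next
      case False
      with p step(1) show ?thesis
        by (intro exI[of _ "x # p"]) (cases p, auto simp: adjacent_def)
    qed
  qed
  then show ?thesis using that by blast
qed

lemma path_imp_reachable:
  assumes "p \<noteq> []" "path_edges p \<subseteq> edges G"
  shows "(adjacent G)\<^sup>*\<^sup>* (hd p) (last p)"
  using assms
proof (induction p rule: path_edges.induct)
  case (1 x y xs)
  from 1 have "(adjacent G)\<^sup>*\<^sup>* y (last (y # xs))" by simp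
  moreover from 1 have "adjacent G x y" by (simp add: adjacent_def)
  ultimately show ?case by (simp add: converse_rtranclp_into_rtranclp)
qed auto

lemma reachable_sym: "(adjacent G)\<^sup>*\<^sup>* x y \<Longrightarrow> (adjacent G)\<^sup>*\<^sup>* y x"
proof -
  have "symp (adjacent G)" by (auto simp: symp_def adjacent_def insert_commute)
  then show "(adjacent G)\<^sup>*\<^sup>* x y \<Longrightarrow> (adjacent G)\<^sup>*\<^sup>* y x"
    by (meson sympD symp_rtranclp)
qed

text \<open>The ear from \<open>y\<close> through \<open>q\<close> to \<open>w\<close> replaces the
  segment of \<open>p\<close> between \<open>y\<close> and \<open>w\<close>. Only vertices strictly
  between these two are dropped, so the ends of \<open>p\<close> survive. \<open>q\<close> may be
  empty: then the ear is a single edge.\<close>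

lemma path_ear:
  assumes p: "distinct p" "path_edges p \<subseteq> E" and y: "y \<in> set p" and w: "w \<in> set p" and "y \<noteq> w"
    and q: "distinct q" "set q \<inter> set p = {}" "path_edges (y # q @ [w]) \<subseteq> E"
  obtains p' where "distinct p'" "p' \<noteq> []" "hd p' = hd p" "last p' = last p" "path_edges p' \<subseteq> E"
    "path_edges (y # q @ [w]) \<subseteq> path_edges p'"
proof -
  note result = that
  \<comment> \<open>Both orders of \<open>y\<close> and \<open>w\<close> along \<open>p\<close> at
    once: \<open>s\<close> is the one that comes first, \<open>t\<close> the other, and
    \<open>r\<close> is \<open>q\<close> or its reverse accordingly.\<close>
  have *: thesis if "p = p1 @ s # m @ t # p3" "distinct r" "set r \<inter> set p = {}"
    "path_edges (s # r @ [t]) = path_edges (y # q @ [w])" for p1 s m t p3 r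
  proof (rule result)
    let ?p' = "p1 @ s # r @ t # p3"
    have e': "path_edges ?p' = path_edges (p1 @ [s]) \<union> path_edges (s # r @ [t]) \<union> path_edges (t # p3)"
      using path_edges_append[of p1 s "r @ t # p3"] path_edges_append[of "s # r" t p3] by auto
    have e: "path_edges p = path_edges (p1 @ [s]) \<union> path_edges (s # m @ [t]) \<union> path_edges (t # p3)"
      using path_edges_append[of p1 s "m @ t # p3"] path_edges_append[of "s # m" t p3] \<open>p = _\<close> by auto
    show "path_edges ?p' \<subseteq> E" using e e' p(2) q(3) that(4) by auto
    show "path_edges (y # q @ [w]) \<subseteq> path_edges ?p'" using e' that(4) by auto
    show "distinct ?p'" using that p(1) by auto
    show "?p' \<noteq> []" by simp
    show "hd ?p' = hd p" "last ?p' = last p" using \<open>p = _\<close> by (cases p1; simp)+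
  qed
  from y obtain p1 p2 where sp: "p = p1 @ y # p2" by (meson split_list)
  with w \<open>y \<noteq> w\<close> consider "w \<in> set p2" | "w \<in> set p1" by auto
  then show thesis
  proof cases
    case 1
    then obtain m p3 where "p2 = m @ w # p3" by (meson split_list)
    with sp q show thesis by (intro *[of p1 y m w p3 q]) auto
  next
    case 2
    then obtain p0 m where "p1 = p0 @ w # m" by (meson split_list)
    with sp q path_edges_rev[of "y # q @ [w]"] show thesis
      by (intro *[of p0 w m y p2 "rev q"]) auto
  qed
qed

section \<open>Circuits\<close>

lemma circuit_of_path:
  assumes "distinct p" "3 \<le> length p" "path_edges p \<subseteq> edges G" "{hd p, last p} \<in> edges G"
  shows "circuit G (insert {hd p, last p} (path_edges p))"
  unfolding circuit_def
proof (intro exI[of _ p] conjI)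
  let ?n = "length p"
  have ne: "p \<noteq> []" using assms(2) by auto
  \<comment> \<open>The index wraps around only at \<open>?n - 1\<close>, where it yields the
    closing edge; all other indices give the edges of the path.\<close>
  have "{{p ! i, p ! (Suc i mod ?n)} | i. i < ?n} =
    insert {p ! (?n - 1), p ! 0} {{p ! i, p ! Suc i} | i. Suc i < ?n}" (is "?A = insert _ ?B")
  proof (intro equalityI subsetI)
    fix e assume "e \<in> ?A"
    then obtain i where "i < ?n" "e = {p ! i, p ! (Suc i mod ?n)}" by blast
    then have "i = ?n - 1 \<and> e = {p ! i, p ! 0} \<or> Suc i < ?n \<and> e = {p ! i, p ! Suc i}"
      by (cases "Suc i = ?n") auto
    then show "e \<in> insert {p ! (?n - 1), p ! 0} ?B"
      by blast
  next
    fix e assume "e \<in> insert {p ! (?n - 1), p ! 0} ?B"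
    then consider "e = {p ! (?n - 1), p ! 0}" | i where "e = {p ! i, p ! Suc i}" "Suc i < ?n"
      by blast
    then show "e \<in> ?A"
    proof cases
      case 1
      with ne show ?thesis by (intro CollectI exI[of _ "?n - 1"]) auto
    next
      case (2 i)
      then show ?thesis by (intro CollectI exI[of _ i]) auto
    qed
  qed
  then show "insert {hd p, last p} (path_edges p) = {{p ! i, p ! (Suc i mod ?n)} | i. i < ?n}"
    using ne by (simp add: path_edges_conv_nth hd_conv_nth last_conv_nth insert_commute)
qed (use assms in auto)

text \<open>In the cyclic order a vertex at position \<open>k\<close> lies only on the edges
  starting at \<open>k\<close> and at its predecessor. These differ because a circuit has at least
  three vertices.\<close>

lemma circuit_at_vertex:
  assumes "circuit G C" "e \<in> C" "v \<in> e"
  obtains e' where "e' \<noteq> e" "{g \<in> C. v \<in> g} = {e, e'}"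
proof -
  from assms(1) obtain vs where vs: "3 \<le> length vs" "distinct vs"
    and C: "C = {{vs ! i, vs ! (Suc i mod length vs)} | i. i < length vs}"
    unfolding circuit_def by blast
  define n where "n = length vs"
  define E where "E i = {vs ! i, vs ! (Suc i mod n)}" for i
  have C': "C = E ` {..<n}" unfolding C E_def n_def by auto
  have "n \<ge> 3" using vs n_def by simp
  then have "Suc i mod n < n" for i by simp
  then have "v \<in> set vs"
    using assms(2,3) unfolding C' E_def n_def by auto
  then obtain k where k: "k < n" "vs ! k = v" by (auto simp: in_set_conv_nth n_def)
  \<comment> \<open>The cyclic predecessor of \<open>k\<close>; position 0 is preceded by the last
    one.\<close>
  define k' where "k' = (if k = 0 then n - 1 else k - 1)"
  have k': "k' < n" "Suc k' mod n = k"
    using k \<open>n \<ge> 3\<close> by (auto simp: k'_def)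
  have nth: "vs ! i = vs ! j \<longleftrightarrow> i = j" if "i < n" "j < n" for i j
    using that vs(2) by (simp add: n_def nth_eq_iff_index_eq)
  have at: "v \<in> E i \<longleftrightarrow> i = k \<or> i = k'" if "i < n" for i
  proof -
    have "v \<in> E i \<longleftrightarrow> k = i \<or> k = Suc i mod n"
      using that k nth[of k i] nth[of k "Suc i mod n"] \<open>n \<ge> 3\<close> by (auto simp: E_def)
    also have "\<dots> \<longleftrightarrow> i = k \<or> i = k'"
      using that k(1) \<open>n \<ge> 3\<close> by (cases "Suc i = n") (auto simp: k'_def)
    finally show ?thesis .
  qed
  have star: "{g \<in> C. v \<in> g} = {E k, E k'}"
    unfolding C' using at k(1) k'(1) by auto
  \<comment> \<open>The predecessor vertex tells the two edges apart: as \<open>n\<close> is at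
    least 3, \<open>k'\<close> is neither \<open>k\<close> nor the cyclic successor of
    \<open>k\<close>.\<close>
  have "vs ! k' \<notin> E k"
  proof -
    have "k' \<noteq> k" "k' \<noteq> Suc k mod n"
      using k(1) \<open>n \<ge> 3\<close> by (cases "Suc k = n"; auto simp: k'_def)+
    with nth k(1) k'(1) \<open>n \<ge> 3\<close> show ?thesis by (auto simp: E_def)
  qed
  then have "E k \<noteq> E k'" by (auto simp: E_def)
  moreover have "e \<in> {E k, E k'}" using assms(2,3) star by blast
  ultimately show thesis using that star by (metis insert_commute insertE singletonD)
qed

text \<open>The image of \<open>C\<close> is a circuit through \<open>v\<close>, hence has exactly
  one edge at \<open>v\<close> besides \<open>f h\<close>. Injectivity of \<open>f\<close> carries
  this count back to \<open>C\<close>.\<close>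

lemma circuit_edge_preimage_star:
  assumes "circuit_injection G G' f" "circuit G C" "h \<in> C" "h \<in> edge_preimage G f (star G' v)"
  obtains e where "e \<noteq> h" "C \<inter> edge_preimage G f (star G' v) = {h, e}"
proof -
  let ?T = "edge_preimage G f (star G' v)"
  from assms(1) have bij: "bij_betw f (edges G) (edges G')" and fC: "circuit G' (f ` C)"
    using assms(2) by (auto simp: circuit_injection_def)
  have fh: "f h \<in> f ` C" "v \<in> f h"
    using assms(3,4) by (auto simp: edge_preimage_def star_def)
  from circuit_at_vertex[OF fC fh]
  obtain g where g: "g \<noteq> f h" "{g \<in> f ` C. v \<in> g} = {f h, g}" .
  have CE: "C \<subseteq> edges G" using assms(2) by (auto simp: circuit_def)
  have T: "C \<inter> ?T = {e \<in> C. v \<in> f e}"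
    using CE bij_betw_apply[OF bij] by (auto simp: edge_preimage_def star_def)
  have "g \<in> {g \<in> f ` C. v \<in> g}" unfolding g(2) by simp
  then obtain e where e: "e \<in> C" "v \<in> f e" "g = f e" by blast
  have "f d = f h \<or> f d = f e" if "d \<in> C" "v \<in> f d" for d
    using g(2) that unfolding e(3) by (metis (mono_tags, lifting) imageI insertE mem_Collect_eq singletonD)
  moreover have "inj_on f C" using bij CE by (meson bij_betw_def inj_on_subset)
  ultimately have "d = h \<or> d = e" if "d \<in> C" "v \<in> f d" for d
    using that e(1) assms(3) by (metis inj_onD)
  then have "C \<inter> ?T = {h, e}"
    unfolding T using e(1,2) assms(3) fh(2) by blast
  moreover have "e \<noteq> h" using g(1) e(3) by blast
  ultimately show thesis using that by blast
qed

section \<open>2-connected graphs\<close>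

lemma two_connected_reachable:
  assumes "k_connected 2 G" "x \<in> verts G" "y \<in> verts G"
  shows "(adjacent G)\<^sup>*\<^sup>* x y"
proof -
  have "connected_graph (delete_verts G {})"
    using assms(1) by (auto simp: k_connected_def)
  moreover have "adjacent (delete_verts G {}) = adjacent G"
    by (auto simp: delete_verts_def adjacent_def fun_eq_iff)
  ultimately show ?thesis
    using assms by (auto simp: connected_graph_def delete_verts_def)
qed

lemma two_connected_path_avoiding:
  assumes "k_connected 2 G" "x \<in> verts G - {y}" "z \<in> verts G - {y}" "y \<in> verts G"
  obtains q where "distinct q" "q \<noteq> []" "hd q = x" "last q = z" "path_edges q \<subseteq> edges G" "y \<notin> set q"
proof -
  let ?H = "delete_verts G {y}"
  have "connected_graph ?H"
    using assms(1,4) by (simp add: k_connected_def)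
  then have "(adjacent ?H)\<^sup>*\<^sup>* x z"
    using assms by (auto simp: connected_graph_def delete_verts_def)
  then obtain q where q: "distinct q" "q \<noteq> []" "hd q = x" "last q = z" "path_edges q \<subseteq> edges ?H"
    by (rule reachable_imp_path)
  have "y \<notin> set q"
  \<comment> \<open>A one-vertex path has no edges from which to read off that it avoids
    \<open>y\<close>; there \<open>x\<close> \<noteq> \<open>y\<close> decides.\<close>
  proof (cases "2 \<le> length q")
    case True
    with q(5) Union_path_edges[OF True] show ?thesis by (auto simp: delete_verts_def)
  next
    case False
    with q(2) obtain u where "q = [u]" by (cases q; cases "tl q") auto
    with q(3) assms(2) show ?thesis by auto
  qed
  with q that show thesis by (auto simp: delete_verts_def)
qed

text \<open>Any edge at a vertex of a path from \<open>a\<close> to \<open>b\<close> can be absorbed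
  by rerouting the path along an ear. Repeating this along a walk from \<open>a\<close> brings an
  end of \<open>e\<close> onto such a path, and one more rerouting brings in \<open>e\<close>
  itself.\<close>

lemma two_connected_path_through_edge:
  assumes G: "simple_graph G" "k_connected 2 G"
    and ab: "a \<in> verts G" "b \<in> verts G" "a \<noteq> b" and e: "e \<in> edges G"
  obtains p where "distinct p" "p \<noteq> []" "hd p = a" "last p = b" "path_edges p \<subseteq> edges G"
    "e \<in> path_edges p"
proof -
  define P where "P p \<longleftrightarrow> distinct p \<and> p \<noteq> [] \<and> hd p = a \<and> last p = b \<and> path_edges p \<subseteq> edges G" for p
  have extend: "\<exists>p. P p \<and> {y, x} \<in> path_edges p" if p: "P p" "y \<in> set p" and yx: "{y, x} \<in> edges G"
    for p x y
  proof -
    have xy: "x \<noteq> y" "x \<in> verts G" "y \<in> verts G"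
      using yx G(1) by (auto simp: simple_graph_def)
    \<comment> \<open>At least one end of \<open>p\<close> differs from \<open>y\<close>, so a route
      from \<open>x\<close> that avoids \<open>y\<close> can be made to return to
      \<open>p\<close>.\<close>
    obtain z where z: "z \<in> {a, b}" "z \<noteq> y" using ab by blast
    have zp: "z \<in> set p" using z p(1) by (auto simp: P_def)
    obtain q where q: "distinct q" "q \<noteq> []" "hd q = x" "last q = z" "path_edges q \<subseteq> edges G" "y \<notin> set q"
      using two_connected_path_avoiding[OF G(2), of x y z] xy z ab by blast
    have "\<exists>w\<in>set q. w \<in> set p" using zp q(2,4) last_in_set by blast
    \<comment> \<open>Stopping at the first vertex \<open>w\<close> on \<open>p\<close> keeps the
      interior of the ear off \<open>p\<close>. If \<open>x\<close> itself lies on \<open>p\<close>,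
      then \<open>w\<close> is \<open>x\<close> and the ear is just the edge.\<close>
    from split_list_first_prop[OF this]
    obtain q1 w q2 where s: "q = q1 @ w # q2" "w \<in> set p" "\<forall>u\<in>set q1. u \<notin> set p"
      by blast
    have ear: "path_edges (y # q1 @ [w]) = insert {y, x} (path_edges (q1 @ [w]))"
      using q(3) s(1) by (cases q1) auto
    have "path_edges (y # q1 @ [w]) \<subseteq> edges G"
      using ear yx q(5) s(1) path_edges_append[of q1 w q2] by auto
    moreover have "distinct q1" "set q1 \<inter> set p = {}" "y \<noteq> w" using q s by auto
    moreover have "distinct p" "path_edges p \<subseteq> edges G" using p(1) by (simp_all add: P_def)
    ultimately obtain p' where "distinct p'" "p' \<noteq> []" "hd p' = hd p" "last p' = last p"
      "path_edges p' \<subseteq> edges G" "path_edges (y # q1 @ [w]) \<subseteq> path_edges p'"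
      using path_ear[of p "edges G" y w q1] p(2) s(2) by blast
    with p(1) ear show ?thesis by (intro exI[of _ p']) (auto simp: P_def)
  qed
  have reach: "\<exists>p. P p \<and> y \<in> set p" if "(adjacent G)\<^sup>*\<^sup>* a y" for y
    using that
  proof (induction rule: rtranclp_induct)
    case base
    obtain p where "P p"
      using reachable_imp_path[OF two_connected_reachable[OF G(2) ab(1,2)]] unfolding P_def by metis
    then show ?case by (auto simp: P_def)
  next
    case (step y z)
    then obtain p where "P p" "{y, z} \<in> path_edges p"
      using extend unfolding adjacent_def by blast
    then show ?case
      using Union_path_edges_subset[of p] by blast
  qed
  obtain x y where xy: "e = {y, x}" "y \<in> verts G"
    using e G(1) by (auto simp: simple_graph_def card_2_iff)
  with reach two_connected_reachable[OF G(2) ab(1)] obtain p where "P p" "y \<in> set p" by blast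
  with extend e xy obtain p where "P p" "e \<in> path_edges p" by blast
  with that show thesis by (auto simp: P_def)
qed

section \<open>Components\<close>

text \<open>An explicit reachability class with all edges inside it, to be matched with the maximal
  connected subgraphs of \<open>components\<close>.\<close>

definition component_of :: "'v ugraph \<Rightarrow> 'v \<Rightarrow> 'v ugraph" where
  "component_of H x = \<lparr>verts = {y. (adjacent H)\<^sup>*\<^sup>* x y},
     edges = {e \<in> edges H. e \<subseteq> {y. (adjacent H)\<^sup>*\<^sup>* x y}}\<rparr>"

lemma verts_component_of: "verts (component_of H x) = {y. (adjacent H)\<^sup>*\<^sup>* x y}"
  by (simp add: component_of_def)

text \<open>Every initial part of a walk from \<open>x\<close> ends in the class of
  \<open>x\<close>, so the walk never leaves it.\<close>

lemma reachable_in_component_of: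
  "(adjacent H)\<^sup>*\<^sup>* x y \<Longrightarrow> (adjacent (component_of H x))\<^sup>*\<^sup>* x y"
proof (induction rule: rtranclp_induct)
  case (step y z)
  then have "(adjacent H)\<^sup>*\<^sup>* x z" by simp
  with step(1,2) have "adjacent (component_of H x) y z"
    using adjacent_def[of H y z] adjacent_def[of "component_of H x" y z]
    by (simp add: component_of_def)
  with step show ?case by simp
qed simp

lemma reachable_in_verts:
  assumes "simple_graph H" "(adjacent H)\<^sup>*\<^sup>* x y" "x \<in> verts H"
  shows "y \<in> verts H"
  using assms(2,3) by induction (use assms(1) in \<open>auto simp: adjacent_def simple_graph_def\<close>)

lemma subgraph_component_of:
  assumes "simple_graph H" "x \<in> verts H"
  shows "subgraph (component_of H x) H"
  using assms reachable_in_verts[OF assms(1) _ assms(2)]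
  by (auto simp: subgraph_def simple_graph_def component_of_def)

lemma connected_component_of: "connected_graph (component_of H x)"
  unfolding connected_graph_def verts_component_of
  by (metis (mono_tags, lifting) empty_Collect_eq mem_Collect_eq reachable_in_component_of
      reachable_sym rtranclp.rtrancl_refl rtranclp_trans)

lemma connected_subgraph_component_of:
  assumes "subgraph K H" "connected_graph K" "x \<in> verts K"
  shows "subgraph K (component_of H x)"
proof -
  have "adjacent K \<le> adjacent H" using assms(1) by (auto simp: adjacent_def subgraph_def)
  then have "(adjacent K)\<^sup>*\<^sup>* \<le> (adjacent H)\<^sup>*\<^sup>*" by (rule rtranclp_mono)
  then have "verts K \<subseteq> {y. (adjacent H)\<^sup>*\<^sup>* x y}"
    using assms(2,3) by (auto simp: connected_graph_def)
  with assms(1) show ?thesis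
    by (fastforce simp: subgraph_def simple_graph_def component_of_def)
qed

lemma subgraph_antisym: "subgraph H K \<Longrightarrow> subgraph K H \<Longrightarrow> H = K"
  by (auto simp: subgraph_def)

text \<open>\<open>component_of H x\<close> is the largest connected subgraph containing
  \<open>x\<close>. A maximal connected subgraph therefore equals the class of any of its vertices,
  and each class is maximal.\<close>

lemma components_eq:
  assumes "simple_graph H"
  shows "components H = component_of H ` verts H"
proof (intro equalityI subsetI)
  fix K assume "K \<in> components H"
  then have K: "subgraph K H" "connected_graph K"
    "\<And>L. subgraph L H \<Longrightarrow> connected_graph L \<Longrightarrow> subgraph K L \<Longrightarrow> L = K"
    by (auto simp: components_def)
  from K(1,2) obtain x where x: "x \<in> verts K" "x \<in> verts H"
    by (auto simp: connected_graph_def subgraph_def)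
  with K assms have "component_of H x = K"
    by (simp add: subgraph_component_of connected_component_of connected_subgraph_component_of)
  with x show "K \<in> component_of H ` verts H" by auto
next
  fix K assume "K \<in> component_of H ` verts H"
  then obtain x where x: "x \<in> verts H" "K = component_of H x" by auto
  have "L = K" if L: "subgraph L H" "connected_graph L" "subgraph K L" for L
  proof -
    have "x \<in> verts L" using L(3) x(2) by (auto simp: subgraph_def verts_component_of)
    with L x(2) show ?thesis
      by (metis connected_subgraph_component_of subgraph_antisym)
  qed
  with x assms show "K \<in> components H"
    by (auto simp: components_def subgraph_component_of connected_component_of)
qed

lemma component_of_eq: "(adjacent H)\<^sup>*\<^sup>* x y \<Longrightarrow> component_of H x = component_of H y"
proof -
  assume "(adjacent H)\<^sup>*\<^sup>* x y"
  then have "(adjacent H)\<^sup>*\<^sup>* x = (adjacent H)\<^sup>*\<^sup>* y"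
    by (auto simp: fun_eq_iff dest: reachable_sym rtranclp_trans)
  then show ?thesis by (simp add: component_of_def)
qed

section \<open>The preimage of a star\<close>

lemma edge_preimage_star_ends_separated:
  assumes "circuit_injection G G' f"
    and h: "{a, b} \<in> edge_preimage G f (star G' v)"
    and "a \<noteq> b"
  shows "\<not> (adjacent (delete_edges G (edge_preimage G f (star G' v))))\<^sup>*\<^sup>* a b"
proof
  let ?T = "edge_preimage G f (star G' v)"
  assume "(adjacent (delete_edges G ?T))\<^sup>*\<^sup>* a b"
  moreover have "edges (delete_edges G ?T) = edges G - ?T" by (simp add: delete_edges_def)
  ultimately obtain p where p: "distinct p" "p \<noteq> []" "hd p = a" "last p = b"
    "path_edges p \<subseteq> edges G - ?T"
    using reachable_imp_path[of "delete_edges G ?T" a b] by metis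
  \<comment> \<open>One vertex would give \<open>a = b\<close>, and two would make
    \<open>{a, b}\<close>, an edge of \<open>?T\<close>, an edge of \<open>p\<close>.\<close>
  have "3 \<le> length p"
  proof (rule ccontr)
    assume "\<not> 3 \<le> length p"
    moreover have "length p \<noteq> 0" using p(2) by simp
    ultimately have "length p = 1 \<or> length p = 2" by linarith
    then have "p = [a] \<or> p = [a, b]"
      using p(3,4) by (auto simp: length_Suc_conv numeral_2_eq_2)
    then show False
    proof
      assume "p = [a]"
      with p(4) \<open>a \<noteq> b\<close> show False by simp
    next
      assume "p = [a, b]"
      then have "{a, b} \<in> path_edges p" by simp
      with p(5) h show False by blast
    qed
  qed
  moreover have "{a, b} \<in> edges G" using h by (simp add: edge_preimage_def)
  ultimately have "circuit G (insert {a, b} (path_edges p))"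
    using circuit_of_path[of p G] p by auto
  then obtain e where "e \<noteq> {a, b}" "insert {a, b} (path_edges p) \<inter> ?T = {{a, b}, e}"
    using circuit_edge_preimage_star[OF assms(1) _ _ h] by (metis insertI1)
  with p(5) show False by blast
qed

text \<open>A path from \<open>a\<close> to \<open>b\<close> through \<open>e\<close>, closed by
  \<open>{a, b}\<close>, is a circuit whose only edges in the preimage are these two. Cutting the
  path at \<open>e\<close> leaves the two required connections; \<open>x\<close> is the end of
  \<open>e\<close> met first from \<open>a\<close>.\<close>

lemma edge_preimage_star_same_ends:
  assumes G: "simple_graph G" "k_connected 2 G" and f: "circuit_injection G G' f"
    and h: "{a, b} \<in> edge_preimage G f (star G' v)" and e: "e \<in> edge_preimage G f (star G' v)"
  defines "R \<equiv> (adjacent (delete_edges G (edge_preimage G f (star G' v))))\<^sup>*\<^sup>*"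
  obtains x y where "e = {x, y}" "R a x" "R b y"
proof (cases "e = {a, b}")
  case True
  then show thesis using that unfolding R_def by blast
next
  case False
  let ?T = "edge_preimage G f (star G' v)"
  let ?H = "delete_edges G ?T"
  have HE: "edges ?H = edges G - ?T" by (simp add: delete_edges_def)
  have TE: "?T \<subseteq> edges G" by (auto simp: edge_preimage_def)
  have "{a, b} \<in> edges G" using h TE by blast
  with G(1) have "{a, b} \<subseteq> verts G \<and> card {a, b} = 2" unfolding simple_graph_def by blast
  then have ab: "a \<in> verts G" "b \<in> verts G" "a \<noteq> b" by auto
  obtain p where p: "distinct p" "p \<noteq> []" "hd p = a" "last p = b" "path_edges p \<subseteq> edges G"
    "e \<in> path_edges p"
    using two_connected_path_through_edge[OF G ab] e TE by blast
  obtain p1 x y p2 where s: "p = p1 @ x # y # p2" "e = {x, y}"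
    using path_edges_split[OF p(6)] by blast
  \<comment> \<open>With only two vertices the path would be the edge \<open>{a, b}\<close>, forcing
    \<open>e = {a, b}\<close>.\<close>
  have "length p \<noteq> 2"
  proof
    assume "length p = 2"
    with s p(3,4) False show False by auto
  qed
  moreover have "2 \<le> length p" using s(1) by simp
  ultimately have "3 \<le> length p" by linarith
  then have "circuit G (insert {a, b} (path_edges p))"
    using circuit_of_path[of p G] p h TE by auto
  then obtain g where "insert {a, b} (path_edges p) \<inter> ?T = {{a, b}, g}"
    using circuit_edge_preimage_star[OF f _ _ h] by (metis insertI1)
  then have T: "path_edges p \<inter> ?T \<subseteq> {{a, b}, e}"
    using e p(6) False by blast
  have pe: "path_edges p = path_edges (p1 @ [x]) \<union> {{x, y}} \<union> path_edges (y # p2)"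
    using path_edges_append[of p1 x "y # p2"] s(1) by auto
  \<comment> \<open>The pieces before and after \<open>e\<close> share no vertex. As
    \<open>a\<close>, \<open>x\<close> lie on one and \<open>b\<close>, \<open>y\<close> on the
    other, neither piece can contain \<open>{a, b}\<close> or \<open>e\<close>.\<close>
  have dj: "set (p1 @ [x]) \<inter> set (y # p2) = {}" using p(1) s(1) by auto
  have "a \<in> set (p1 @ [x])" using p(3) s(1) by (cases p1) auto
  moreover have "b \<in> set (y # p2)" using p(4) s(1) by auto
  ultimately have "{a, b} \<notin> path_edges (p1 @ [x])" "{a, b} \<notin> path_edges (y # p2)"
    using dj Union_path_edges_subset[of "p1 @ [x]"] Union_path_edges_subset[of "y # p2"] by blast+
  moreover have "e \<notin> path_edges (p1 @ [x])" "e \<notin> path_edges (y # p2)"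
    using dj Union_path_edges_subset[of "p1 @ [x]"] Union_path_edges_subset[of "y # p2"] unfolding s(2) by auto
  ultimately have "path_edges (p1 @ [x]) \<subseteq> edges ?H" "path_edges (y # p2) \<subseteq> edges ?H"
    using T pe p(5) unfolding HE by blast+
  then have "R (hd (p1 @ [x])) x" "R y (last (y # p2))"
    using path_imp_reachable[of "p1 @ [x]" ?H] path_imp_reachable[of "y # p2" ?H]
    by (auto simp: R_def)
  moreover have "hd (p1 @ [x]) = a" using p(3) s(1) by (cases p1) auto
  moreover have "last (y # p2) = b" using p(4) s(1) by simp
  ultimately have "R a x" "R b y"
    using reachable_sym[of ?H y b] by (auto simp: R_def)
  with that s(2) show thesis by blast
qed

theorem theorem3:
  fixes G :: "'a ugraph" and G' :: "'b ugraph" and f :: "'a set \<Rightarrow> 'b set" and v :: 'b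
  assumes "simple_graph G" and "k_connected 2 G"
    and "simple_graph G'"
    and "circuit_injection G G' f"
    and "v \<in> verts G'"
  shows "\<exists>G1 G2. G1 \<noteq> G2 \<and>
           components (delete_edges G (edge_preimage G f (star G' v))) = {G1, G2} \<and>
           G = add_edges (graph_union G1 G2) (edge_preimage G f (star G' v)) \<and>
           (\<forall>e \<in> edge_preimage G f (star G' v). \<exists>x \<in> verts G1. \<exists>y \<in> verts G2. e = {x, y})"
proof -
  define T where "T = edge_preimage G f (star G' v)"
  define H where "H = delete_edges G T"
  have TE: "T \<subseteq> edges G" by (auto simp: T_def edge_preimage_def)
  have H: "verts H = verts G" "edges H = edges G - T" "simple_graph H"
    using assms(1) by (auto simp: H_def delete_edges_def simple_graph_def)
  \<comment> \<open>\<open>v\<close> is not isolated, so \<open>T\<close> is nonempty; one of its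
    edges supplies the vertices \<open>a\<close> and \<open>b\<close> that name the two
    components.\<close>
  obtain g where g: "g \<in> star G' v" using assms(4,5) by (fastforce simp: circuit_injection_def)
  then have "g \<in> f ` edges G"
    using assms(4) by (simp add: circuit_injection_def star_def bij_betw_def)
  with g obtain h where h: "h \<in> T" by (auto simp: T_def edge_preimage_def)
  with TE assms(1) have "h \<subseteq> verts G" "card h = 2" by (auto simp: simple_graph_def)
  with h obtain a b where ab: "{a, b} \<in> T" "a \<in> verts G" "b \<in> verts G" "a \<noteq> b"
    by (auto simp: card_2_iff)
  define G1 G2 where "G1 = component_of H a" and "G2 = component_of H b"
  have ends: "\<exists>x \<in> verts G1. \<exists>y \<in> verts G2. e = {x, y}" if "e \<in> T" for e
    using edge_preimage_star_same_ends[OF assms(1,2,4), of a b v e] ab(1) that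
    unfolding G1_def G2_def verts_component_of T_def[symmetric] H_def[symmetric] by blast
  have "\<not> (adjacent H)\<^sup>*\<^sup>* a b"
    using edge_preimage_star_ends_separated[OF assms(4), of a b v] ab by (simp add: T_def H_def)
  then have "b \<in> verts G2" "b \<notin> verts G1" by (simp_all add: G1_def G2_def verts_component_of)
  then have "G1 \<noteq> G2" by auto
  \<comment> \<open>A walk from \<open>a\<close> in \<open>G\<close> never leaves the two classes:
    an edge of \<open>T\<close> has both ends in them by \<open>ends\<close>, and any other edge
    stays within one class.\<close>
  have cover: "y \<in> verts G1 \<union> verts G2" if "(adjacent G)\<^sup>*\<^sup>* a y" for y
    using that
  proof (induction rule: rtranclp_induct)
    case base
    then show ?case by (simp add: G1_def verts_component_of)
  next
    case (step y z)
    show ?case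
    proof (cases "{y, z} \<in> T")
      case True
      with ends show ?thesis by (fastforce simp: doubleton_eq_iff)
    next
      case False
      with step(2) H have "adjacent H y z" by (simp add: adjacent_def)
      with step(3) show ?thesis
        by (auto simp: G1_def G2_def verts_component_of intro: rtranclp.rtrancl_into_rtrancl)
    qed
  qed
  have sub: "subgraph G1 H" "subgraph G2 H"
    using ab H by (auto simp: G1_def G2_def intro: subgraph_component_of)
  have V: "verts G = verts G1 \<union> verts G2"
    using cover two_connected_reachable[OF assms(2) ab(2)] sub H(1) by (auto simp: subgraph_def)
  have "component_of H x \<in> {G1, G2}" if "x \<in> verts G" for x
    using that unfolding V
    by (auto simp: G1_def G2_def verts_component_of dest: component_of_eq)
  then have "components H = {G1, G2}"
    using ab H by (auto simp: components_eq G1_def G2_def)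
  \<comment> \<open>The ends of an edge of \<open>H\<close> are adjacent in \<open>H\<close>, so
    both lie in the class that contains one of them.\<close>
  moreover have "e \<in> edges G1 \<union> edges G2" if e: "e \<in> edges H" for e
  proof -
    have "e \<subseteq> verts G" "card e = 2" using e H by (auto simp: simple_graph_def)
    then obtain x y where xy: "e = {x, y}" "x \<in> verts G" by (auto simp: card_2_iff)
    with e have "adjacent H x y" by (simp add: adjacent_def)
    with xy V e show ?thesis
      by (auto simp: G1_def G2_def component_of_def intro: rtranclp.rtrancl_into_rtrancl)
  qed
  then have "edges G = edges G1 \<union> edges G2 \<union> T"
    using sub H(2) TE by (auto simp: subgraph_def)
  with V have "G = add_edges (graph_union G1 G2) T"
    by (simp add: add_edges_def graph_union_def)
  ultimately show ?thesis
    using \<open>G1 \<noteq> G2\<close> ends unfolding H_def T_def by blast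
qed

end
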